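(* Let $(W,S)$ be a finite Coxeter system and let $W'\subset W$ be a (not necessarily standard) parabolic subgroup. There is a unique function $\phi\colon W\to W'$ satisfying: (a) $\phi$ is $W'$-equivariant: $\phi(wx)=w\phi(x)$ for all $w\in W'$, $x\in W$; (b) for all $x\in W$ and $w\in W'$, if $\phi(x)\le'\phi(wx)$, then $x\le wx$. In particular, $\phi$ restricts to the identity map on $W'$.
   Context: Let $R=\bigcup_{w\in W} wSw^{-1}$ be the set of reflections of $(W,S)$ and $l$ its length function. The Bruhat-Chevalley order $\le$ on $W$ is the partial order generated by: $x<y$ if $l(x)<l(y)$ and $xy^{-1}\in R$. For $I\subset S$ let $W_I$ be the subgroup generated by $I$. A parabolic subgroup of $W$ is a subgroup $W'$ conjugate to some $W_I$. Write $W'=zW_Iz^{-1}$ with $z$ of minimal length in the coset $zW_I$. Then $W'$ is a Coxeter group with simple reflections $S'=zIz^{-1}$ (this set depends only on $W'$) and reflections $R'=R\cap W'$. The Bruhat-Chevalley order of the Coxeter system $(W',S')$ is denoted $\le'$; it need not be the restriction of $\le$ to $W'$. *)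

theory Defs
  imports "HOL-Algebra.Algebra"
begin

definition word_prod :: "('a, 'b) monoid_scheme \<Rightarrow> 'a list \<Rightarrow> 'a" where
  "word_prod G ws = foldr (\<lambda>x y. x \<otimes>\<^bsub>G\<^esub> y) ws \<one>\<^bsub>G\<^esub>"

text \<open>
  The congruence on words over \<open>S\<close> generated by the Coxeter relations
  \<open>(s t)\<^sup>m = 1\<close> with \<open>m\<close> the order of \<open>s t\<close>.  If \<open>s t\<close> has infinite order,
  \<^const>\<open>group.ord\<close> is \<open>0\<close> and the relation is trivial, as it should be.
  For \<open>s = t\<close> an involution, \<open>m = 1\<close> and the relation is \<open>s s = 1\<close>; hence formal
  inverses of generators are not needed, and the quotient of the monoid of words is the
  group with this presentation.
\<close>

inductive coxeter_equiv :: "('a, 'b) monoid_scheme \<Rightarrow> 'a set \<Rightarrow> 'a list \<Rightarrow> 'a list \<Rightarrow> bool"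
  for G S where
  refl: "set u \<subseteq> S \<Longrightarrow> coxeter_equiv G S u u"
| sym: "coxeter_equiv G S u v \<Longrightarrow> coxeter_equiv G S v u"
| trans: "coxeter_equiv G S u v \<Longrightarrow> coxeter_equiv G S v w \<Longrightarrow> coxeter_equiv G S u w"
| relator: "set u \<subseteq> S \<Longrightarrow> set v \<subseteq> S \<Longrightarrow> s \<in> S \<Longrightarrow> t \<in> S \<Longrightarrow>
    coxeter_equiv G S (u @ concat (replicate (group.ord G (s \<otimes>\<^bsub>G\<^esub> t)) [s, t]) @ v) (u @ v)"

locale coxeter_system = group G for G (structure) +
  fixes S :: "'a set"
  assumes gens_closed: "S \<subseteq> carrier G"
    and gens_order: "s \<in> S \<Longrightarrow> ord s = 2"
    and gens_generate: "generate G S = carrier G"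
    and presentation: "set u \<subseteq> S \<Longrightarrow> set v \<subseteq> S \<Longrightarrow>
      word_prod G u = word_prod G v \<longleftrightarrow> coxeter_equiv G S u v"

definition cox_length :: "('a, 'b) monoid_scheme \<Rightarrow> 'a set \<Rightarrow> 'a \<Rightarrow> nat" where
  "cox_length G S x = (LEAST n. \<exists>ws. set ws \<subseteq> S \<and> length ws = n \<and> word_prod G ws = x)"

definition reflections :: "('a, 'b) monoid_scheme \<Rightarrow> 'a set \<Rightarrow> 'a set" where
  "reflections G S = {w \<otimes>\<^bsub>G\<^esub> s \<otimes>\<^bsub>G\<^esub> inv\<^bsub>G\<^esub> w |w s. w \<in> carrier G \<and> s \<in> S}"

definition bruhat_step :: "('a, 'b) monoid_scheme \<Rightarrow> 'a set \<Rightarrow> 'a \<Rightarrow> 'a \<Rightarrow> bool" where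
  "bruhat_step G S x y \<longleftrightarrow> x \<in> carrier G \<and> y \<in> carrier G \<and>
     cox_length G S x < cox_length G S y \<and> x \<otimes>\<^bsub>G\<^esub> inv\<^bsub>G\<^esub> y \<in> reflections G S"

definition bruhat_le :: "('a, 'b) monoid_scheme \<Rightarrow> 'a set \<Rightarrow> 'a \<Rightarrow> 'a \<Rightarrow> bool" where
  "bruhat_le G S = (bruhat_step G S)\<^sup>*\<^sup>*"

definition conj_set :: "('a, 'b) monoid_scheme \<Rightarrow> 'a \<Rightarrow> 'a set \<Rightarrow> 'a set" where
  "conj_set G z H = (\<lambda>h. z \<otimes>\<^bsub>G\<^esub> h \<otimes>\<^bsub>G\<^esub> inv\<^bsub>G\<^esub> z) ` H"

definition parabolic_subgroup :: "('a, 'b) monoid_scheme \<Rightarrow> 'a set \<Rightarrow> 'a set \<Rightarrow> bool" where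
  "parabolic_subgroup G S W' \<longleftrightarrow>
     (\<exists>I z. I \<subseteq> S \<and> z \<in> carrier G \<and> W' = conj_set G z (generate G I))"

text \<open>
  \<open>S'\<close> is the set of simple reflections of the parabolic subgroup \<open>W'\<close>.  It is determined
  by \<open>W'\<close>, although \<open>I\<close> and \<open>z\<close> are not; it is kept as a relation so that results hold for
  every choice of \<open>I\<close> and \<open>z\<close>.
\<close>

definition parabolic_simples ::
    "('a, 'b) monoid_scheme \<Rightarrow> 'a set \<Rightarrow> 'a set \<Rightarrow> 'a set \<Rightarrow> bool" where
  "parabolic_simples G S W' S' \<longleftrightarrow>
     (\<exists>I z. I \<subseteq> S \<and> z \<in> carrier G \<and> W' = conj_set G z (generate G I) \<and>
        (\<forall>y \<in> z <#\<^bsub>G\<^esub> generate G I. cox_length G S z \<le> cox_length G S y) \<and>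
        S' = conj_set G z I)"

lemma (in coxeter_system) parabolic_simples_exists:
  assumes "parabolic_subgroup G S W'"
  shows "\<exists>S'. parabolic_simples G S W' S'"
proof -
  from assms obtain I z where I: "I \<subseteq> S" and z: "z \<in> carrier G"
    and W': "W' = conj_set G z (generate G I)"
    unfolding parabolic_subgroup_def by blast
  let ?H = "generate G I"
  have sub: "subgroup ?H G"
    using I gens_closed by (intro generate_is_subgroup) auto
  have HG: "?H \<subseteq> carrier G"
    using sub by (rule subgroup.subset)
  have "z \<in> z <# ?H"
    using lcos_self[OF z sub] .
  then obtain y where y: "y \<in> z <# ?H"
    and ymin: "\<And>y'. y' \<in> z <# ?H \<Longrightarrow> cox_length G S y \<le> cox_length G S y'"
    using ex_has_least_nat[of "\<lambda>y. y \<in> z <# ?H" z "cox_length G S"] by blast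
  from y obtain h where h: "h \<in> ?H" and yh: "y = z \<otimes> h"
    unfolding l_coset_def by blast
  have hG: "h \<in> carrier G" using h HG by blast
  have yG: "y \<in> carrier G" using yh z hG by simp
  have coset: "y <# ?H = z <# ?H"
    using l_repr_independence[OF y z sub] by simp
  have "conj_set G y ?H = W'"
  proof -
    have 1: "y \<otimes> k \<otimes> inv y = z \<otimes> (h \<otimes> k \<otimes> inv h) \<otimes> inv z" if "k \<in> ?H" for k
      using that HG z hG by (auto simp: yh m_assoc inv_mult_group)
    have 2: "(\<lambda>k. h \<otimes> k \<otimes> inv h) ` ?H = ?H"
    proof (intro equalityI subsetI)
      fix k assume "k \<in> (\<lambda>k. h \<otimes> k \<otimes> inv h) ` ?H"
      then show "k \<in> ?H"
        using h sub by (auto intro!: subgroup.m_closed subgroup.m_inv_closed)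
    next
      fix k assume k: "k \<in> ?H"
      then have kG: "k \<in> carrier G" using HG by blast
      have "inv h \<otimes> k \<otimes> h \<in> ?H"
        using h k sub by (auto intro!: subgroup.m_closed subgroup.m_inv_closed)
      moreover have "k = h \<otimes> (inv h \<otimes> k \<otimes> h) \<otimes> inv h"
        using hG kG m_assoc[of h "inv h" k] by (simp add: m_assoc)
      ultimately show "k \<in> (\<lambda>k. h \<otimes> k \<otimes> inv h) ` ?H" by blast
    qed
    have "conj_set G y ?H = (\<lambda>k. z \<otimes> k \<otimes> inv z) ` ((\<lambda>k. h \<otimes> k \<otimes> inv h) ` ?H)"
      unfolding conj_set_def image_image using 1 by (intro image_cong) auto
    then show ?thesis
      unfolding 2 by (simp add: W' conj_set_def)
  qed
  then show ?thesis
    unfolding parabolic_simples_def using I yG ymin coset by metis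
qed

text \<open>
  Membership in the extensional function space makes uniqueness of \<open>\<phi>\<close> mean uniqueness of
  its values on the group.  The order on \<open>W'\<close> is the Bruhat order of the Coxeter system
  \<open>(W', S')\<close>, with its own length function; it is not restricted from \<open>G\<close>.
\<close>

definition equivariant_order_map ::
    "('a, 'b) monoid_scheme \<Rightarrow> 'a set \<Rightarrow> 'a set \<Rightarrow> 'a set \<Rightarrow> ('a \<Rightarrow> 'a) \<Rightarrow> bool" where
  "equivariant_order_map G S W' S' \<phi> \<longleftrightarrow>
     \<phi> \<in> carrier G \<rightarrow>\<^sub>E W' \<and>
     (\<forall>w \<in> W'. \<forall>x \<in> carrier G. \<phi> (w \<otimes>\<^bsub>G\<^esub> x) = w \<otimes>\<^bsub>G\<^esub> \<phi> x) \<and>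
     (\<forall>x \<in> carrier G. \<forall>w \<in> W'.
        bruhat_le (G\<lparr>carrier := W'\<rparr>) S' (\<phi> x) (\<phi> (w \<otimes>\<^bsub>G\<^esub> x)) \<longrightarrow>
        bruhat_le G S x (w \<otimes>\<^bsub>G\<^esub> x))"

end

theory Submission
  imports Defs
begin

text \<open>
  Tits' cocycle: for a word $s_1 \cdots s_k$ count modulo 2 how often $t$ occurs among
  $s_1 \cdots s_{i-1} s_i s_{i-1} \cdots s_1$.  This parity respects the Coxeter relations, so it
  depends only on the element $g$ that the word spells, and for a reflection $t$ it is odd iff
  $t$ is a left inversion of $g$.  The same argument with words over $I \subseteq S$ shows that
  inversions by reflections of $W_I$ may be tested with the length function of $W_I$.

  Let $m$ be of minimal length in $W'x$ and put $\phi(x) = x m^{-1}$.  Reflections of $W'$ are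
  inversions neither of $m$ nor of the minimal $z$ in $W' = z W_I z^{-1}$, so by the cocycle rule
  a reflection of $W'$ is an inversion of $x$ iff it is one of $\phi(x)$ for the Coxeter system
  $(W', S')$; this gives (b).  Conversely (b) forces $\phi^{-1}(1)$ to meet every coset $W'x$ in
  its Bruhat minimum, which determines $\phi$.
\<close>

section \<open>Words and lengths\<close>

lemma word_prod_Nil [simp]: "word_prod G [] = \<one>\<^bsub>G\<^esub>"
  by (simp add: word_prod_def)

lemma word_prod_Cons [simp]: "word_prod G (s # ws) = s \<otimes>\<^bsub>G\<^esub> word_prod G ws"
  by (simp add: word_prod_def)

lemma word_prod_carrier_update [simp]: "word_prod (G\<lparr>carrier := H\<rparr>) ws = word_prod G ws"
  by (simp add: word_prod_def)

lemma cox_length_carrier_update [simp]: "cox_length (G\<lparr>carrier := H\<rparr>) A x = cox_length G A x"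
  by (simp add: cox_length_def)

lemma cox_length_word_prod_le: "set ws \<subseteq> A \<Longrightarrow> cox_length G A (word_prod G ws) \<le> length ws"
  unfolding cox_length_def by (rule Least_le) auto

lemma cox_length_reduced_word:
  assumes "set ws \<subseteq> A"
  obtains us where "set us \<subseteq> A" "word_prod G us = word_prod G ws"
    "length us = cox_length G A (word_prod G ws)"
proof -
  have "\<exists>n us. set us \<subseteq> A \<and> length us = n \<and> word_prod G us = word_prod G ws"
    using assms by blast
  from LeastI_ex[OF this] show thesis
    using that unfolding cox_length_def by blast
qed

lemma cox_length_eq_transport:
  assumes "\<And>ws. set ws \<subseteq> A \<and> word_prod G ws = x \<Longrightarrow>
      \<exists>us. set us \<subseteq> B \<and> length us = length ws \<and> word_prod G us = y"
    and "\<And>us. set us \<subseteq> B \<and> word_prod G us = y \<Longrightarrow>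
      \<exists>ws. set ws \<subseteq> A \<and> length ws = length us \<and> word_prod G ws = x"
  shows "cox_length G A x = cox_length G B y"
proof -
  have "(\<exists>ws. set ws \<subseteq> A \<and> length ws = n \<and> word_prod G ws = x) \<longleftrightarrow>
      (\<exists>us. set us \<subseteq> B \<and> length us = n \<and> word_prod G us = y)" for n
    using assms by metis
  then show ?thesis unfolding cox_length_def by simp
qed

text \<open>Each generating step strictly raises the length, so chains do too; antisymmetry follows
  from this.\<close>

lemma bruhat_le_length:
  assumes "bruhat_le G S x y"
  shows "x = y \<or> cox_length G S x < cox_length G S y"
  using assms unfolding bruhat_le_def
  by (induction rule: rtranclp_induct) (auto simp: bruhat_step_def)

lemma bruhat_le_antisym: "bruhat_le G S x y \<Longrightarrow> bruhat_le G S y x \<Longrightarrow> x = y"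
  using bruhat_le_length[of G S x y] bruhat_le_length[of G S y x] by auto

context group
begin

lemma mult_inv_cancel_left: "x \<in> carrier G \<Longrightarrow> y \<in> carrier G \<Longrightarrow> x \<otimes> (inv x \<otimes> y) = y"
  by (simp add: m_assoc[symmetric])

lemma inv_mult_cancel_left: "x \<in> carrier G \<Longrightarrow> y \<in> carrier G \<Longrightarrow> inv x \<otimes> (x \<otimes> y) = y"
  by (simp add: m_assoc[symmetric])

lemma word_prod_closed [intro, simp]: "set ws \<subseteq> carrier G \<Longrightarrow> word_prod G ws \<in> carrier G"
  by (induction ws) auto

lemma word_prod_append:
  "set u \<subseteq> carrier G \<Longrightarrow> set v \<subseteq> carrier G \<Longrightarrow>
    word_prod G (u @ v) = word_prod G u \<otimes> word_prod G v"
  by (induction u) (auto simp: m_assoc)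

lemma word_prod_conj:
  assumes z: "z \<in> carrier G" and ws: "set ws \<subseteq> carrier G"
  shows "word_prod G (map (\<lambda>h. z \<otimes> h \<otimes> inv z) ws) = z \<otimes> word_prod G ws \<otimes> inv z"
  using ws
proof (induction ws)
  case Nil
  then show ?case using z by simp
next
  case (Cons s ws)
  then have "word_prod G ws \<in> carrier G" by auto
  then show ?case using Cons z by (simp add: m_assoc mult_inv_cancel_left inv_mult_cancel_left)
qed

text \<open>Conjugation by \<open>z\<close> acts letter by letter and is injective, so it matches
  words over \<open>I\<close> with words over \<open>conj_set G z I\<close>. This carries lengths in
  W_I over to lengths in W'.\<close>

lemma cox_length_conj:
  assumes z: "z \<in> carrier G" and I: "I \<subseteq> carrier G" and u: "u \<in> carrier G"
  shows "cox_length G (conj_set G z I) (z \<otimes> u \<otimes> inv z) = cox_length G I u"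
proof (rule cox_length_eq_transport[symmetric])
  fix ws assume "set ws \<subseteq> I \<and> word_prod G ws = u"
  then show "\<exists>us. set us \<subseteq> conj_set G z I \<and> length us = length ws \<and>
      word_prod G us = z \<otimes> u \<otimes> inv z"
    using z I by (intro exI[of _ "map (\<lambda>h. z \<otimes> h \<otimes> inv z) ws"])
      (auto simp: conj_set_def word_prod_conj)
next
  fix us assume us: "set us \<subseteq> conj_set G z I \<and> word_prod G us = z \<otimes> u \<otimes> inv z"
  then have "us \<in> lists ((\<lambda>h. z \<otimes> h \<otimes> inv z) ` I)"
    by (auto simp: conj_set_def in_lists_conv_set)
  then obtain ws where ws: "ws \<in> lists I" "us = map (\<lambda>h. z \<otimes> h \<otimes> inv z) ws"
    by (auto simp: lists_image)
  then have wsI: "set ws \<subseteq> I" by auto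
  then have "z \<otimes> word_prod G ws \<otimes> inv z = z \<otimes> u \<otimes> inv z"
    using us ws z I by (simp add: word_prod_conj)
  moreover have "word_prod G ws \<in> carrier G" using wsI I by auto
  ultimately have "word_prod G ws = u" using z u by simp
  then show "\<exists>ws. set ws \<subseteq> I \<and> length ws = length us \<and> word_prod G ws = u"
    using wsI ws by auto
qed

section \<open>The reflection cocycle\<close>

text \<open>Splitting off the first letter \<open>s\<close> conjugates all later reflections of the
  word by \<open>s\<close>, so the tail is tested at \<open>inv s \<otimes> t \<otimes> s\<close>;
  the exclusive or keeps only the parity.\<close>

primrec crossing :: "'a list \<Rightarrow> 'a \<Rightarrow> bool" where
  "crossing [] t = False"
| "crossing (s # ws) t = ((s = t) \<noteq> crossing ws (inv s \<otimes> t \<otimes> s))"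

lemma crossing_append:
  assumes "set u \<subseteq> carrier G" "set v \<subseteq> carrier G" "t \<in> carrier G"
  shows "crossing (u @ v) t =
    (crossing u t \<noteq> crossing v (inv (word_prod G u) \<otimes> t \<otimes> word_prod G u))"
  using assms
proof (induction u arbitrary: t)
  case Nil
  then show ?case by simp
next
  case (Cons s u)
  have c: "s \<in> carrier G" "word_prod G u \<in> carrier G" "set u \<subseteq> carrier G"
    using Cons.prems by auto
  have "inv (word_prod G (s # u)) \<otimes> t \<otimes> word_prod G (s # u) =
      inv (word_prod G u) \<otimes> (inv s \<otimes> t \<otimes> s) \<otimes> word_prod G u"
    using c Cons.prems by (simp add: inv_mult_group m_assoc)
  moreover have "crossing (u @ v) (inv s \<otimes> t \<otimes> s) = (crossing u (inv s \<otimes> t \<otimes> s) \<noteq>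
      crossing v (inv (word_prod G u) \<otimes> (inv s \<otimes> t \<otimes> s) \<otimes> word_prod G u))"
    using Cons.IH[of "inv s \<otimes> t \<otimes> s"] Cons.prems c by simp
  ultimately show ?case
    by (simp del: word_prod_Cons) blast
qed

text \<open>An odd count is nonzero, so \<open>t\<close> is one of the reflections read off the
  word, and multiplying by it cancels the corresponding letter: the exchange condition. No new
  letters appear, so words over \<open>I\<close> stay over \<open>I\<close>.\<close>

lemma crossing_deletion:
  assumes "set ws \<subseteq> carrier G" "\<And>s. s \<in> set ws \<Longrightarrow> s \<otimes> s = \<one>" "t \<in> carrier G" "crossing ws t"
  shows "\<exists>us. set us \<subseteq> set ws \<and> length us < length ws \<and>
    word_prod G us = t \<otimes> word_prod G ws"
  using assms
proof (induction ws arbitrary: t)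
  case Nil
  then show ?case by simp
next
  case (Cons s ws)
  have c: "s \<in> carrier G" "word_prod G ws \<in> carrier G" "set ws \<subseteq> carrier G" "s \<otimes> s = \<one>"
    using Cons.prems by auto
  show ?case
  proof (cases "s = t")
    case True
    then have "t \<otimes> word_prod G (s # ws) = word_prod G ws"
      using c m_assoc[of s s "word_prod G ws"] by simp
    then show ?thesis by (intro exI[of _ ws]) auto
  next
    case False
    then have "crossing ws (inv s \<otimes> t \<otimes> s)" using Cons.prems by simp
    then obtain us where us: "set us \<subseteq> set ws" "length us < length ws"
        "word_prod G us = inv s \<otimes> t \<otimes> s \<otimes> word_prod G ws"
      using Cons.IH[of "inv s \<otimes> t \<otimes> s"] Cons.prems c by auto
    have "word_prod G (s # us) = t \<otimes> word_prod G (s # ws)"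
      using us c Cons.prems by (simp add: m_assoc mult_inv_cancel_left inv_mult_cancel_left)
    then show ?thesis using us by (intro exI[of _ "s # us"]) auto
  qed
qed

section \<open>Alternating words and the Coxeter relators\<close>

lemma word_prod_alternating:
  assumes "s \<in> carrier G" "t \<in> carrier G"
  shows "word_prod G (concat (replicate n [s, t])) = (s \<otimes> t) [^] n"
proof (induction n)
  case (Suc n)
  have "(s \<otimes> t) [^] Suc n = (s \<otimes> t) \<otimes> (s \<otimes> t) [^] n"
    using assms by (subst nat_pow_Suc2) auto
  then show ?case using Suc assms by (simp add: m_assoc)
qed simp

text \<open>The letters of the alternating word read off the reflections s, sts, ststs, and so on,
  which are the elements \<open>(s \<otimes> t) [^] k \<otimes> s\<close>; the sum counts the hits
  at \<open>r\<close>.\<close>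

lemma crossing_alternating:
  fixes n :: nat
  assumes s: "s \<in> carrier G" "s \<otimes> s = \<one>" and t: "t \<in> carrier G" "t \<otimes> t = \<one>"
    and r: "r \<in> carrier G"
  shows "crossing (concat (replicate n [s, t])) r \<longleftrightarrow>
    odd (\<Sum>k<2 * n. of_bool ((s \<otimes> t) [^] k \<otimes> s = r) :: nat)"
proof (induction n)
  case 0
  then show ?case by simp
next
  case (Suc n)
  define q where "q = s \<otimes> t"
  have inv: "inv s = s" "inv t = t" using s t inv_equality by auto
  have q: "q \<in> carrier G" using s t by (simp add: q_def)
  have iq: "inv q = t \<otimes> s" unfolding q_def using inv_mult_group[OF s(1) t(1)] inv by simp
  have sq: "s \<otimes> inv q = q \<otimes> s" unfolding iq using s t by (simp add: q_def m_assoc)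
  \<comment> \<open>\<open>s\<close> conjugates \<open>q\<close> to its inverse, hence moves across
    a power of \<open>q\<close> by inverting that power.\<close>
  have sqn: "s \<otimes> inv (q [^] n) = q [^] n \<otimes> s" for n :: nat
  proof (induction n)
    case (Suc n)
    have "s \<otimes> inv (q [^] Suc n) = s \<otimes> inv q \<otimes> inv (q [^] n)"
      using q s by (simp add: inv_mult_group m_assoc)
    also have "\<dots> = q \<otimes> (s \<otimes> inv (q [^] n))" using q s by (simp add: sq m_assoc)
    also have "\<dots> = q \<otimes> q [^] n \<otimes> s" using q s by (simp add: Suc m_assoc)
    finally show ?case using q by (simp add: nat_pow_Suc2[symmetric])
  qed (use s in simp)
  have conj: "a = inv (q [^] n) \<otimes> r \<otimes> q [^] n \<longleftrightarrow> q [^] n \<otimes> a \<otimes> inv (q [^] n) = r"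
    if "a \<in> carrier G" for a
  proof
    assume "a = inv (q [^] n) \<otimes> r \<otimes> q [^] n"
    then show "q [^] n \<otimes> a \<otimes> inv (q [^] n) = r"
      using q r by (simp add: m_assoc mult_inv_cancel_left inv_mult_cancel_left)
  next
    assume "q [^] n \<otimes> a \<otimes> inv (q [^] n) = r"
    then have "r = q [^] n \<otimes> a \<otimes> inv (q [^] n)" by simp
    then show "a = inv (q [^] n) \<otimes> r \<otimes> q [^] n"
      using q that by (simp add: m_assoc mult_inv_cancel_left inv_mult_cancel_left)
  qed
  \<comment> \<open>The first n pairs spell \<open>q [^] n\<close>, so the next two letters
    contribute its conjugates of \<open>s\<close> and of \<open>q \<otimes> s\<close>, that is of
    sts; these are the terms with indices 2n and 2n + 1.\<close>
  have 1: "q [^] n \<otimes> s \<otimes> inv (q [^] n) = q [^] (2 * n) \<otimes> s"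
    using q s sqn[of n] by (simp add: m_assoc mult_2 nat_pow_mult[symmetric])
  have 2: "q [^] n \<otimes> (q \<otimes> s) \<otimes> inv (q [^] n) = q [^] Suc (2 * n) \<otimes> s"
  proof -
    have "q [^] n \<otimes> (q \<otimes> s) \<otimes> inv (q [^] n) = q [^] n \<otimes> q \<otimes> (q [^] n \<otimes> s)"
      using q s sqn[of n] by (simp add: m_assoc)
    also have "\<dots> = q [^] Suc n \<otimes> q [^] n \<otimes> s" using q s by (simp add: m_assoc)
    also have "q [^] Suc n \<otimes> q [^] n = q [^] Suc (2 * n)"
      using q by (simp only: nat_pow_mult) (simp add: mult_2)
    finally show ?thesis .
  qed
  let ?w = "concat (replicate n [s, t])"
  let ?r = "inv (q [^] n) \<otimes> r \<otimes> q [^] n"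
  \<comment> \<open>The new pair is split off at the end, not the front, so that the induction
    hypothesis applies to the same \<open>r\<close>.\<close>
  have rep: "concat (replicate (Suc n) [s, t]) = ?w @ [s, t]"
    by (simp only: replicate_Suc replicate_append_same[symmetric] concat_append) simp
  have "crossing (concat (replicate (Suc n) [s, t])) r = (crossing ?w r \<noteq> crossing [s, t] ?r)"
    unfolding rep using s t r word_prod_alternating[of s t n]
    by (subst crossing_append) (auto simp: q_def)
  also have "crossing [s, t] ?r \<longleftrightarrow> ((s = ?r) \<noteq> (q \<otimes> s = ?r))"
  proof -
    have "t = s \<otimes> (?r \<otimes> s) \<longleftrightarrow> s \<otimes> t = ?r \<otimes> s"
      using s t q r inv by (metis inv_solve_left m_closed inv_closed nat_pow_closed)
    also have "\<dots> \<longleftrightarrow> q \<otimes> s = ?r"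
      using s t q r inv inv_solve_right[of ?r q s] by (auto simp: q_def)
    finally show ?thesis using s t q r inv by (simp add: m_assoc)
  qed
  also have "s = ?r \<longleftrightarrow> q [^] (2 * n) \<otimes> s = r"
    using conj[of s] s 1 by simp
  also have "q \<otimes> s = ?r \<longleftrightarrow> q [^] Suc (2 * n) \<otimes> s = r"
    using conj[of "q \<otimes> s"] s q 2 by simp
  finally show ?case using Suc by (simp add: q_def)
qed

text \<open>The dihedral reflections $(st)^k s$ have period $m$ in $k$, so $2m$ letters meet each of
  them an even number of times.\<close>

lemma not_crossing_relator:
  assumes s: "s \<in> carrier G" "s \<otimes> s = \<one>" and t: "t \<in> carrier G" "t \<otimes> t = \<one>"
    and r: "r \<in> carrier G"
  shows "\<not> crossing (concat (replicate (ord (s \<otimes> t)) [s, t])) r"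
proof -
  define m where "m = ord (s \<otimes> t)"
  define f :: "nat \<Rightarrow> nat" where "f k = of_bool ((s \<otimes> t) [^] k \<otimes> s = r)" for k
  \<comment> \<open>Infinite order is encoded as \<open>ord\<close> equal to 0; the relator is then
    empty and \<open>m = 0\<close> fits the same computation.\<close>
  have "(s \<otimes> t) [^] m = \<one>" using s t by (simp add: m_def)
  then have "f (k + m) = f k" for k
    using s t by (simp add: f_def nat_pow_mult[symmetric])
  moreover have "sum f {..<2 * m} = sum f {..<m} + (\<Sum>k<m. f (k + m))"
    using sum.atLeastLessThan_concat[of 0 m "2 * m" f]
      sum.shift_bounds_nat_ivl[of f 0 m m]
    by (simp add: atLeast0LessThan mult_2)
  ultimately have "even (sum f {..<2 * m})" by simp
  then show ?thesis
    using crossing_alternating[OF assms, of m] by (simp add: m_def f_def)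
qed

end

section \<open>Inversions in a Coxeter system\<close>

context coxeter_system
begin

lemma generator_closed: "s \<in> S \<Longrightarrow> s \<in> carrier G"
  using gens_closed by blast

lemma generator_square: "s \<in> S \<Longrightarrow> s \<otimes> s = \<one>"
  using pow_ord_eq_1[of s] gens_order[of s] generator_closed[of s] by (simp add: numeral_2_eq_2)

lemma generator_inv: "s \<in> S \<Longrightarrow> inv s = s"
  using inv_equality generator_square generator_closed by auto

text \<open>Generators are their own inverses, so words without formal inverses exhaust the
  generated subgroup.\<close>

lemma generate_word:
  assumes "I \<subseteq> S" "g \<in> generate G I"
  obtains ws where "set ws \<subseteq> I" "word_prod G ws = g"
proof -
  have "\<exists>ws. set ws \<subseteq> I \<and> word_prod G ws = g"
    using assms(2)
  proof induction
    case one
    then show ?case by (intro exI[of _ "[]"]) auto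
  next
    case (incl s)
    then show ?case using assms generator_closed by (intro exI[of _ "[s]"]) auto
  next
    case (inv s)
    then show ?case using assms generator_closed generator_inv[of s]
      by (intro exI[of _ "[s]"]) auto
  next
    case (eng g h)
    then obtain u v where "set u \<subseteq> I" "word_prod G u = g" "set v \<subseteq> I" "word_prod G v = h"
      by blast
    then show ?case using assms gens_closed
      by (intro exI[of _ "u @ v"]) (auto simp: word_prod_append)
  qed
  then show thesis using that by blast
qed

lemma carrier_word:
  assumes "g \<in> carrier G"
  obtains ws where "set ws \<subseteq> S" "word_prod G ws = g"
  using generate_word[of S g] assms gens_generate by auto

text \<open>An inserted relator contributes even parity, and since it spells \<open>\<one>\<close>
  the letters after it are conjugated as before.\<close>

lemma coxeter_equiv_crossing:
  assumes "coxeter_equiv G S u v"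
  shows "set u \<subseteq> S \<and> set v \<subseteq> S \<and> (\<forall>t \<in> carrier G. crossing u t = crossing v t)"
  using assms
proof induction
  case (relator u v s t)
  let ?w = "concat (replicate (ord (s \<otimes> t)) [s, t])"
  have st: "s \<in> carrier G" "t \<in> carrier G" "s \<otimes> s = \<one>" "t \<otimes> t = \<one>"
    using relator generator_closed generator_square by auto
  have w: "set ?w \<subseteq> S" using relator by auto
  have c: "set u \<subseteq> carrier G" "set v \<subseteq> carrier G" "set ?w \<subseteq> carrier G"
    using relator w gens_closed by blast+
  have w1: "word_prod G ?w = \<one>" using st by (simp add: word_prod_alternating)
  have "crossing (u @ ?w @ v) r = crossing (u @ v) r" if r: "r \<in> carrier G" for r
  proof -
    let ?r = "inv (word_prod G u) \<otimes> r \<otimes> word_prod G u"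
    have r': "?r \<in> carrier G" using r c by simp
    have "crossing (?w @ v) ?r = crossing v ?r"
      using c r' w1 not_crossing_relator[of s t ?r] st by (subst crossing_append) auto
    then show ?thesis using c r by (simp add: crossing_append)
  qed
  then show ?case using relator w by auto
qed auto

text \<open>The word is an arbitrary choice; \<open>inversion_word_prod\<close> shows that the
  choice does not matter.\<close>

definition inversion :: "'a \<Rightarrow> 'a \<Rightarrow> bool" where
  "inversion g t = crossing (SOME ws. set ws \<subseteq> S \<and> word_prod G ws = g) t"

text \<open>The presentation enters here: two words for one element are Coxeter equivalent, hence
  have the same parity. Any word may therefore be used, also one over a subset of
  \<open>S\<close>.\<close>

lemma inversion_word_prod:
  assumes "set ws \<subseteq> S" "t \<in> carrier G"
  shows "inversion (word_prod G ws) t = crossing ws t"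
proof -
  let ?us = "SOME us. set us \<subseteq> S \<and> word_prod G us = word_prod G ws"
  have "set ?us \<subseteq> S \<and> word_prod G ?us = word_prod G ws"
    by (rule someI[of _ ws]) (use assms in simp)
  then have "coxeter_equiv G S ?us ws" using presentation[of ?us ws] assms by auto
  then show ?thesis using coxeter_equiv_crossing assms unfolding inversion_def by blast
qed

lemma inversion_mult:
  assumes "x \<in> carrier G" "y \<in> carrier G" "t \<in> carrier G"
  shows "inversion (x \<otimes> y) t = (inversion x t \<noteq> inversion y (inv x \<otimes> t \<otimes> x))"
proof -
  obtain u where u: "set u \<subseteq> S" "word_prod G u = x" using carrier_word assms by blast
  obtain v where v: "set v \<subseteq> S" "word_prod G v = y" using carrier_word assms by blast
  have c: "set u \<subseteq> carrier G" "set v \<subseteq> carrier G" using u v gens_closed by auto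
  have "x \<otimes> y = word_prod G (u @ v)" using u v c by (simp add: word_prod_append)
  then have "inversion (x \<otimes> y) t = crossing (u @ v) t"
    using inversion_word_prod[of "u @ v" t] u v assms by simp
  also have "\<dots> = (crossing u t \<noteq> crossing v (inv x \<otimes> t \<otimes> x))"
    using crossing_append[OF c] u assms by simp
  finally show ?thesis
    using inversion_word_prod[of u t] inversion_word_prod[of v "inv x \<otimes> t \<otimes> x"] u v assms by auto
qed

lemma inversion_one: "t \<in> carrier G \<Longrightarrow> \<not> inversion \<one> t"
  using inversion_word_prod[of "[]" t] by simp

lemma inversion_generator: "s \<in> S \<Longrightarrow> inversion s s"
  using inversion_word_prod[of "[s]" s] generator_closed[of s] by simp

text \<open>The cocycle rule for the product of \<open>inv x\<close> and \<open>x\<close>, whose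
  total parity is even.\<close>

lemma inversion_inv:
  assumes "x \<in> carrier G" "t \<in> carrier G"
  shows "inversion (inv x) t = inversion x (x \<otimes> t \<otimes> inv x)"
  using inversion_mult[of "inv x" x t] inversion_one[of t] assms by simp

section \<open>Reflections of standard parabolic subgroups and the length criterion\<close>

definition parabolic_reflections :: "'a set \<Rightarrow> 'a set" where
  "parabolic_reflections I = {u \<otimes> s \<otimes> inv u | u s. u \<in> generate G I \<and> s \<in> I}"

lemma reflections_eq_parabolic: "reflections G S = parabolic_reflections S"
  by (simp add: reflections_def parabolic_reflections_def gens_generate)

lemma generate_closed: "I \<subseteq> S \<Longrightarrow> u \<in> generate G I \<Longrightarrow> u \<in> carrier G"
  using generate_in_carrier[of I u] gens_closed by blast

lemma generate_subgroup: "I \<subseteq> S \<Longrightarrow> subgroup (generate G I) G"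
  using generate_is_subgroup gens_closed by blast

lemma parabolic_reflections_subset:
  assumes "I \<subseteq> S"
  shows "parabolic_reflections I \<subseteq> reflections G S"
  using assms generate_closed[OF assms] by (auto simp: parabolic_reflections_def reflections_def)

lemma reflection_closed: "t \<in> reflections G S \<Longrightarrow> t \<in> carrier G"
  using generator_closed by (auto simp: reflections_def)

lemma parabolic_reflection_in_generate:
  assumes "I \<subseteq> S" "t \<in> parabolic_reflections I"
  shows "t \<in> generate G I"
  using assms generate_subgroup[OF assms(1)] generate.incl[of _ I G]
  by (auto simp: parabolic_reflections_def intro!: subgroup.m_closed subgroup.m_inv_closed)

lemma reflection_conj:
  assumes "t \<in> reflections G S" "x \<in> carrier G"
  shows "x \<otimes> t \<otimes> inv x \<in> reflections G S"
proof -
  obtain w s where ws: "t = w \<otimes> s \<otimes> inv w" "w \<in> carrier G" "s \<in> S"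
    using assms by (auto simp: reflections_def)
  then have "x \<otimes> t \<otimes> inv x = (x \<otimes> w) \<otimes> s \<otimes> inv (x \<otimes> w)"
    using assms generator_closed by (simp add: inv_mult_group m_assoc)
  then show ?thesis using ws assms unfolding reflections_def by blast
qed

lemma parabolic_reflection_conj:
  assumes I: "I \<subseteq> S" and t: "t \<in> parabolic_reflections I" and x: "x \<in> generate G I"
  shows "inv x \<otimes> t \<otimes> x \<in> parabolic_reflections I"
proof -
  obtain u s where us: "t = u \<otimes> s \<otimes> inv u" "u \<in> generate G I" "s \<in> I"
    using t by (auto simp: parabolic_reflections_def)
  have "s \<in> carrier G" "u \<in> carrier G" "x \<in> carrier G"
    using us x generate_closed[OF I] generator_closed I by auto
  then have "inv x \<otimes> t \<otimes> x = (inv x \<otimes> u) \<otimes> s \<otimes> inv (inv x \<otimes> u)"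
    using us by (simp add: inv_mult_group m_assoc)
  moreover have "inv x \<otimes> u \<in> generate G I"
    using us x generate_subgroup[OF I] by (auto intro: subgroup.m_closed subgroup.m_inv_closed)
  ultimately show ?thesis using us unfolding parabolic_reflections_def by blast
qed

lemma reflection_square:
  assumes "t \<in> reflections G S"
  shows "t \<otimes> t = \<one>"
proof -
  obtain w s where ws: "t = w \<otimes> s \<otimes> inv w" "w \<in> carrier G" "s \<in> S"
    using assms by (auto simp: reflections_def)
  have s: "s \<in> carrier G" using ws generator_closed by auto
  have "t \<otimes> t = w \<otimes> (s \<otimes> s) \<otimes> inv w"
    using ws s by (simp add: m_assoc mult_inv_cancel_left inv_mult_cancel_left)
  then show ?thesis using ws s generator_square by simp
qed

lemma reflection_inv: "t \<in> reflections G S \<Longrightarrow> inv t = t"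
  using inv_equality reflection_square reflection_closed by auto

text \<open>When \<open>t\<close> is the conjugate of \<open>s\<close> by \<open>w\<close>, the
  factors \<open>w\<close> and \<open>inv w\<close> contribute equal parities, which cancel, and the
  middle \<open>s\<close> contributes one.\<close>

lemma inversion_self:
  assumes "t \<in> reflections G S"
  shows "inversion t t"
proof -
  obtain w s where ws: "t = w \<otimes> s \<otimes> inv w" "w \<in> carrier G" "s \<in> S"
    using assms by (auto simp: reflections_def)
  have s: "s \<in> carrier G" "inv s = s" using ws generator_closed generator_inv by auto
  have t: "t \<in> carrier G" using assms reflection_closed by simp
  have "inv w \<otimes> t \<otimes> w = s" using ws s by (simp add: m_assoc mult_inv_cancel_left inv_mult_cancel_left)
  then have "inversion (w \<otimes> (s \<otimes> inv w)) t = (inversion w t \<noteq> inversion (s \<otimes> inv w) s)"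
    using inversion_mult[of w "s \<otimes> inv w" t] ws s t by simp
  also have "inversion (s \<otimes> inv w) s = (inversion s s \<noteq> inversion (inv w) s)"
    using inversion_mult[of s "inv w" s] ws s generator_square by simp
  finally show ?thesis
    using inversion_inv[of w s] inversion_generator[of s] ws s by (simp add: m_assoc)
qed

text \<open>The parity may be read off a shortest word over \<open>I\<close>; the exchange condition
  then gives a shorter word over \<open>I\<close> for \<open>t \<otimes> u\<close>.\<close>

lemma inversion_shortens:
  assumes I: "I \<subseteq> S" and u: "u \<in> generate G I" and t: "t \<in> carrier G" and "inversion u t"
  shows "cox_length G I (t \<otimes> u) < cox_length G I u"
proof -
  obtain us where us: "set us \<subseteq> I" "word_prod G us = u"
    using generate_word[OF I u] by blast
  then obtain ws where ws: "set ws \<subseteq> I" "word_prod G ws = u" "length ws = cox_length G I u"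
    using cox_length_reduced_word[of us I G] by auto
  have "crossing ws t" using inversion_word_prod[of ws t] assms ws by auto
  moreover have "set ws \<subseteq> carrier G" using ws I gens_closed by blast
  moreover have "s \<otimes> s = \<one>" if "s \<in> set ws" for s
    using that ws I generator_square by blast
  ultimately obtain vs where vs: "set vs \<subseteq> set ws" "length vs < length ws"
      "word_prod G vs = t \<otimes> u"
    using crossing_deletion[of ws t] t ws by auto
  then have "cox_length G I (t \<otimes> u) \<le> length vs"
    using cox_length_word_prod_le[of vs I G] ws by simp
  then show ?thesis using vs ws by simp
qed

text \<open>For the converse, if \<open>t\<close> is not an inversion of \<open>u\<close>, then it
  is one of \<open>t \<otimes> u\<close>, because \<open>inversion t t\<close> flips the parity; so
  returning from \<open>t \<otimes> u\<close> to \<open>u\<close> shortens. Allowing any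
  \<open>I\<close> covers W_I and, with \<open>I = S\<close>, the whole group.\<close>

lemma inversion_iff_shortens:
  assumes I: "I \<subseteq> S" and u: "u \<in> generate G I" and t: "t \<in> parabolic_reflections I"
  shows "inversion u t \<longleftrightarrow> cox_length G I (t \<otimes> u) < cox_length G I u"
proof
  have tR: "t \<in> reflections G S" using parabolic_reflections_subset I t by blast
  have tc: "t \<in> carrier G" and uc: "u \<in> carrier G"
    using reflection_closed tR generate_closed[OF I] u by auto
  show "inversion u t \<Longrightarrow> cox_length G I (t \<otimes> u) < cox_length G I u"
    using inversion_shortens I u tc by blast
  assume lt: "cox_length G I (t \<otimes> u) < cox_length G I u"
  show "inversion u t"
  proof (rule ccontr)
    assume "\<not> inversion u t"
    then have "inversion (t \<otimes> u) t"
      using inversion_mult[of t u t] tc uc inversion_self[OF tR] by simp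
    moreover have "t \<otimes> u \<in> generate G I"
      using parabolic_reflection_in_generate[OF I t] u generate_subgroup[OF I]
      by (auto intro: subgroup.m_closed)
    ultimately have "cox_length G I (t \<otimes> (t \<otimes> u)) < cox_length G I (t \<otimes> u)"
      using inversion_shortens I tc by blast
    then show False using lt tc uc reflection_square[OF tR] by (simp add: m_assoc[symmetric])
  qed
qed

lemma inversion_iff_length:
  assumes "x \<in> carrier G" "t \<in> reflections G S"
  shows "inversion x t \<longleftrightarrow> cox_length G S (t \<otimes> x) < cox_length G S x"
  using inversion_iff_shortens[of S x t] assms by (simp add: gens_generate reflections_eq_parabolic)

end

section \<open>Parabolic subgroups\<close>

locale minimal_parabolic = coxeter_system +
  fixes I :: "'a set" and z :: 'a and W' S' :: "'a set"
  assumes I: "I \<subseteq> S" and z: "z \<in> carrier G"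
    and W'_eq: "W' = conj_set G z (generate G I)"
    and z_min: "\<And>y. y \<in> z <# generate G I \<Longrightarrow> cox_length G S z \<le> cox_length G S y"
    and S'_eq: "S' = conj_set G z I"
begin

lemma W'_E:
  assumes "w \<in> W'"
  obtains u where "u \<in> generate G I" "u \<in> carrier G" "w = z \<otimes> u \<otimes> inv z"
  using assms generate_closed[OF I] by (auto simp: W'_eq conj_set_def)

lemma W'_subgroup: "subgroup W' G"
proof (rule subgroupI)
  note H = generate_subgroup[OF I]
  show "W' \<subseteq> carrier G" using z by (auto elim!: W'_E)
  show "W' \<noteq> {}" using generate.one by (auto simp: W'_eq conj_set_def)
  fix a assume "a \<in> W'"
  then obtain u where u: "u \<in> generate G I" "u \<in> carrier G" "a = z \<otimes> u \<otimes> inv z" by (rule W'_E)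
  then have "inv a = z \<otimes> inv u \<otimes> inv z" using z by (simp add: inv_mult_group m_assoc)
  then show "inv a \<in> W'"
    using subgroup.m_inv_closed[OF H u(1)] by (auto simp: W'_eq conj_set_def)
  fix b assume "b \<in> W'"
  then obtain v where v: "v \<in> generate G I" "v \<in> carrier G" "b = z \<otimes> v \<otimes> inv z" by (rule W'_E)
  have "a \<otimes> b = z \<otimes> (u \<otimes> v) \<otimes> inv z" using z u v by (simp add: m_assoc mult_inv_cancel_left inv_mult_cancel_left)
  then show "a \<otimes> b \<in> W'"
    using subgroup.m_closed[OF H u(1) v(1)] by (auto simp: W'_eq conj_set_def)
qed

lemma W'_closed: "w \<in> W' \<Longrightarrow> w \<in> carrier G"
  using subgroup.subset[OF W'_subgroup] by blast

lemma S'_subset_W': "S' \<subseteq> W'"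
  unfolding S'_eq W'_eq conj_set_def by (intro image_mono subsetI generate.incl)

abbreviation "G' \<equiv> G\<lparr>carrier := W'\<rparr>"

section \<open>Reflections of the parabolic subgroup\<close>

abbreviation "R' \<equiv> reflections G' S'"

lemma inv_G': "w \<in> W' \<Longrightarrow> inv\<^bsub>G'\<^esub> w = inv w"
  using m_inv_consistent[OF W'_subgroup] by simp

lemma R'_I: "w \<in> W' \<Longrightarrow> s \<in> S' \<Longrightarrow> w \<otimes> s \<otimes> inv w \<in> R'"
  unfolding reflections_def by (rule CollectI, intro exI[of _ w] exI[of _ s]) (simp add: inv_G')

lemma R'_E:
  assumes "t \<in> R'"
  obtains r where "r \<in> parabolic_reflections I" "t = z \<otimes> r \<otimes> inv z"
proof -
  obtain w s where "w \<in> W'" "s \<in> S'" and t: "t = w \<otimes> s \<otimes> inv w"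
    using assms inv_G' by (auto simp: reflections_def)
  then obtain u i where u: "u \<in> generate G I" "u \<in> carrier G" "w = z \<otimes> u \<otimes> inv z"
      and i: "i \<in> I" "s = z \<otimes> i \<otimes> inv z"
    by (auto elim!: W'_E simp: S'_eq conj_set_def)
  have "i \<in> carrier G" using i I generator_closed by blast
  then have "t = z \<otimes> (u \<otimes> i \<otimes> inv u) \<otimes> inv z"
    using t u i z by (simp add: m_assoc mult_inv_cancel_left inv_mult_cancel_left inv_mult_group)
  moreover have "u \<otimes> i \<otimes> inv u \<in> parabolic_reflections I"
    using u i by (auto simp: parabolic_reflections_def)
  ultimately show thesis using that by blast
qed

lemma R'_subset: "R' \<subseteq> reflections G S"
  using parabolic_reflections_subset[OF I] reflection_conj z by (auto elim!: R'_E)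

lemma R'_subset_W': "R' \<subseteq> W'"
proof
  fix t assume "t \<in> R'"
  then obtain r where "r \<in> parabolic_reflections I" "t = z \<otimes> r \<otimes> inv z" by (rule R'_E)
  then show "t \<in> W'"
    using parabolic_reflection_in_generate[OF I] by (auto simp: W'_eq conj_set_def)
qed

lemma R'_conj:
  assumes "t \<in> R'" "w \<in> W'"
  shows "inv w \<otimes> t \<otimes> w \<in> R'"
proof -
  obtain v s where v: "v \<in> W'" "s \<in> S'" "t = v \<otimes> s \<otimes> inv v"
    using assms inv_G' by (auto simp: reflections_def)
  have c: "v \<in> carrier G" "s \<in> carrier G" "w \<in> carrier G"
    using v assms W'_closed S'_subset_W' by auto
  have "inv w \<otimes> t \<otimes> w = (inv w \<otimes> v) \<otimes> s \<otimes> inv (inv w \<otimes> v)"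
    using v c by (simp add: inv_mult_group m_assoc)
  moreover have "inv w \<otimes> v \<in> W'"
    using v assms W'_subgroup by (auto intro: subgroup.m_closed subgroup.m_inv_closed)
  ultimately show ?thesis using R'_I v by metis
qed

text \<open>Multiplying \<open>z\<close> by this reflection gives \<open>z \<otimes> r\<close>,
  which lies in the coset where \<open>z\<close> has minimal length, so nothing is
  shortened.\<close>

lemma not_inversion_z:
  assumes r: "r \<in> parabolic_reflections I"
  shows "\<not> inversion z (z \<otimes> r \<otimes> inv z)"
proof -
  have rR: "r \<in> reflections G S" using r parabolic_reflections_subset[OF I] by blast
  have rc: "r \<in> carrier G" using rR reflection_closed by simp
  have "z \<otimes> r \<otimes> inv z \<otimes> z = z \<otimes> r" using z rc by (simp add: m_assoc)
  moreover have "z \<otimes> r \<in> z <# generate G I"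
    using parabolic_reflection_in_generate[OF I r] by (auto simp: l_coset_def)
  ultimately show ?thesis
    using z_min inversion_iff_length[of z "z \<otimes> r \<otimes> inv z"] reflection_conj[OF rR z] z
    by (simp add: not_less)
qed

text \<open>The cocycle rule splits \<open>w\<close> into contributions of \<open>z\<close>,
  \<open>u\<close> and \<open>inv z\<close>. Minimality of \<open>z\<close> kills the outer two; for
  \<open>u\<close> the length over \<open>I\<close> decides, which conjugation turns into the length
  over \<open>S'\<close>.\<close>

lemma inversion_iff_length':
  assumes t: "t \<in> R'" and w: "w \<in> W'"
  shows "inversion w t \<longleftrightarrow> cox_length G S' (t \<otimes> w) < cox_length G S' w"
proof -
  obtain r where r: "r \<in> parabolic_reflections I" "t = z \<otimes> r \<otimes> inv z" using t by (rule R'_E)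
  obtain u where u: "u \<in> generate G I" "u \<in> carrier G" "w = z \<otimes> u \<otimes> inv z" using w by (rule W'_E)
  have rc: "r \<in> carrier G" using r parabolic_reflections_subset[OF I] reflection_closed by blast
  have tw: "t \<otimes> w = z \<otimes> (r \<otimes> u) \<otimes> inv z"
    using r u rc z by (simp add: m_assoc mult_inv_cancel_left inv_mult_cancel_left)
  have "inv z \<otimes> t \<otimes> z = r" using r rc z by (simp add: m_assoc mult_inv_cancel_left inv_mult_cancel_left)
  then have "inversion (z \<otimes> (u \<otimes> inv z)) t = (inversion z t \<noteq> inversion (u \<otimes> inv z) r)"
    using inversion_mult[of z "u \<otimes> inv z" t] z u rc r by simp
  also have "inversion (u \<otimes> inv z) r = (inversion u r \<noteq> inversion (inv z) (inv u \<otimes> r \<otimes> u))"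
    using inversion_mult[of u "inv z" r] z u rc by simp
  finally have 1: "inversion (z \<otimes> (u \<otimes> inv z)) t =
      (inversion z t \<noteq> (inversion u r \<noteq> inversion (inv z) (inv u \<otimes> r \<otimes> u)))" .
  have 2: "\<not> inversion (inv z) (inv u \<otimes> r \<otimes> u)"
    using inversion_inv[of z "inv u \<otimes> r \<otimes> u"] z u rc
      not_inversion_z[OF parabolic_reflection_conj[OF I r(1) u(1)]] by simp
  have 3: "\<not> inversion z t" using not_inversion_z r by simp
  have "inversion w t = inversion u r" using 1 2 3 u z by (simp add: m_assoc)
  also have "\<dots> \<longleftrightarrow> cox_length G I (r \<otimes> u) < cox_length G I u"
    using inversion_iff_shortens[OF I u(1) r(1)] .
  also have "\<dots> \<longleftrightarrow> cox_length G S' (t \<otimes> w) < cox_length G S' w"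
    using cox_length_conj[OF z, of I] I gens_closed u rc tw by (simp add: S'_eq)
  finally show ?thesis .
qed

section \<open>Minimal coset representatives and the comparison of the two Bruhat orders\<close>

definition coset_minimal :: "'a \<Rightarrow> bool" where
  "coset_minimal m \<longleftrightarrow> m \<in> carrier G \<and> (\<forall>w \<in> W'. cox_length G S m \<le> cox_length G S (w \<otimes> m))"

text \<open>In the cocycle rule \<open>m\<close> is tested at a reflection of W'; multiplying
  \<open>m\<close> by it stays in the coset of \<open>m\<close>, where nothing is shorter.\<close>

lemma inversion_coset_minimal:
  assumes m: "coset_minimal m" and w: "w \<in> W'" and t: "t \<in> R'"
  shows "inversion (w \<otimes> m) t = inversion w t"
proof -
  let ?t = "inv w \<otimes> t \<otimes> w"
  have c: "m \<in> carrier G" "w \<in> carrier G" "t \<in> carrier G"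
    using m w t W'_closed R'_subset_W' by (auto simp: coset_minimal_def)
  have t': "?t \<in> R'" using R'_conj t w by simp
  then have "?t \<in> W'" "?t \<in> reflections G S" using R'_subset R'_subset_W' by auto
  then have "\<not> inversion m ?t"
    using inversion_iff_length[of m ?t] m by (auto simp: coset_minimal_def not_less)
  then show ?thesis using inversion_mult[of w m t] c by simp
qed

text \<open>Right multiplication by \<open>m\<close> leaves the reflection of a step unchanged, and
  on both sides the length inequality says that this reflection is an inversion of the upper
  element; \<open>m\<close> does not affect that condition.\<close>

lemma bruhat_le_coset_minimal:
  assumes m: "coset_minimal m" and le: "bruhat_le G' S' a b"
  shows "bruhat_le G S (a \<otimes> m) (b \<otimes> m)"
  using le unfolding bruhat_le_def
proof (induction rule: rtranclp_induct)
  case base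
  then show ?case by simp
next
  case (step b c)
  have bc: "b \<in> W'" "c \<in> W'" "cox_length G S' b < cox_length G S' c"
    and t: "b \<otimes> inv c \<in> R'"
    using step.hyps(2) inv_G' by (auto simp: bruhat_step_def)
  have cl: "b \<in> carrier G" "c \<in> carrier G" "m \<in> carrier G"
    using bc m W'_closed by (auto simp: coset_minimal_def)
  have tR: "b \<otimes> inv c \<in> reflections G S" using t R'_subset by blast
  have "inversion c (b \<otimes> inv c)"
    using inversion_iff_length'[OF t bc(2)] bc cl by (simp add: m_assoc)
  then have "inversion (c \<otimes> m) (b \<otimes> inv c)"
    using inversion_coset_minimal[OF m bc(2) t] by simp
  then have "cox_length G S (b \<otimes> m) < cox_length G S (c \<otimes> m)"
    using inversion_iff_length[of "c \<otimes> m" "b \<otimes> inv c"] tR cl by (simp add: m_assoc mult_inv_cancel_left inv_mult_cancel_left)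
  moreover have "b \<otimes> m \<otimes> inv (c \<otimes> m) = b \<otimes> inv c"
    using cl by (simp add: inv_mult_group m_assoc mult_inv_cancel_left inv_mult_cancel_left)
  ultimately have "bruhat_step G S (b \<otimes> m) (c \<otimes> m)"
    using cl tR by (simp add: bruhat_step_def)
  then show ?case using step.IH by simp
qed

text \<open>Removing the first letter of a reduced word is one step down, since the two elements
  differ by that simple reflection; induction reaches the empty word.\<close>

lemma bruhat_le_one:
  assumes "w \<in> W'"
  shows "bruhat_le G' S' \<one> w"
proof -
  have S': "s \<in> carrier G" "s \<in> R'" "inv s = s" if "s \<in> S'" for s
  proof -
    show s: "s \<in> carrier G" using that S'_subset_W' W'_closed by blast
    show "s \<in> R'" using R'_I[of \<one> s] that s subgroup.one_closed[OF W'_subgroup] by simp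
    then show "inv s = s" using reflection_inv R'_subset by blast
  qed
  have le: "bruhat_le G' S' \<one> (word_prod G ws)"
    if "set ws \<subseteq> S'" "length ws = cox_length G S' (word_prod G ws)" for ws
    using that
  proof (induction "length ws" arbitrary: ws rule: less_induct)
    case less
    show ?case
    proof (cases ws)
      case Nil
      then show ?thesis by (simp add: bruhat_le_def)
    next
      case (Cons s us)
      have us: "set us \<subseteq> S'" "s \<in> S'" using less.prems Cons by auto
      \<comment> \<open>The tail \<open>us\<close> is replaced by a reduced word of the same
        element, so that the induction hypothesis applies without proving the tail reduced.\<close>
      obtain vs where vs: "set vs \<subseteq> S'" "word_prod G vs = word_prod G us"
          "length vs = cox_length G S' (word_prod G us)"
        using cox_length_reduced_word[OF us(1), of G] by blast
      have lt: "length vs < length ws"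
        using cox_length_word_prod_le[OF us(1), of G] vs Cons by simp
      then have le: "bruhat_le G' S' \<one> (word_prod G us)"
        using less.hyps[of vs] vs by simp
      have in_W': "word_prod G xs \<in> W'" if "set xs \<subseteq> S'" for xs
        using that S'_subset_W' subgroup.one_closed[OF W'_subgroup]
        by (induction xs) (auto intro: subgroup.m_closed[OF W'_subgroup])
      have c: "word_prod G us \<in> carrier G" "s \<in> carrier G" using in_W' us W'_closed S' by auto
      have "word_prod G us \<otimes> inv (s \<otimes> word_prod G us) = s"
        using c S' us by (simp add: inv_mult_group m_assoc[symmetric])
      then have "bruhat_step G' S' (word_prod G us) (word_prod G ws)"
        using in_W'[OF us(1)] in_W'[OF less.prems(1)] lt vs less.prems S'(2)[OF us(2)] inv_G' Cons
        by (simp add: bruhat_step_def)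
      then show ?thesis using le by (simp add: bruhat_le_def)
    qed
  qed
  obtain u where u: "u \<in> generate G I" "u \<in> carrier G" "w = z \<otimes> u \<otimes> inv z"
    using assms by (rule W'_E)
  obtain vs where vs: "set vs \<subseteq> I" "word_prod G vs = u" using generate_word[OF I u(1)] by blast
  let ?vs = "map (\<lambda>h. z \<otimes> h \<otimes> inv z) vs"
  have "set vs \<subseteq> carrier G" using vs I gens_closed by blast
  then have "word_prod G ?vs = w" using word_prod_conj[OF z] vs u by simp
  moreover have "set ?vs \<subseteq> S'" using vs by (auto simp: S'_eq conj_set_def)
  ultimately obtain us where "set us \<subseteq> S'" "word_prod G us = w" "length us = cox_length G S' w"
    using cox_length_reduced_word[of ?vs S' G] by auto
  then show ?thesis using le[of us] by simp
qed

text \<open>The representative depends on $x$ only through the coset $W'x$, which makes the resulting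
  map equivariant.\<close>

definition coset_rep :: "'a \<Rightarrow> 'a" where
  "coset_rep x = arg_min (cox_length G S) (\<lambda>y. y \<in> W' #> x)"

lemma coset_rep:
  assumes x: "x \<in> carrier G"
  shows "coset_minimal (coset_rep x)" "x \<otimes> inv (coset_rep x) \<in> W'"
proof -
  have "x \<in> W' #> x" using rcos_self[OF x W'_subgroup] .
  from arg_min_nat_lemma[of "\<lambda>y. y \<in> W' #> x", OF this, of "cox_length G S"]
  have 1: "coset_rep x \<in> W' #> x"
    and 2: "\<And>y. y \<in> W' #> x \<Longrightarrow> cox_length G S (coset_rep x) \<le> cox_length G S y"
    by (auto simp: coset_rep_def)
  obtain v where v: "v \<in> W'" "coset_rep x = v \<otimes> x" using 1 by (auto simp: r_coset_def)
  have vc: "v \<in> carrier G" using v W'_closed by simp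
  have "x \<otimes> inv (coset_rep x) = inv v"
    using v vc x by (simp add: inv_mult_group m_assoc[symmetric])
  then show "x \<otimes> inv (coset_rep x) \<in> W'"
    using subgroup.m_inv_closed[OF W'_subgroup v(1)] by simp
  have "cox_length G S (coset_rep x) \<le> cox_length G S (w \<otimes> coset_rep x)" if "w \<in> W'" for w
  proof (rule 2)
    have "w \<otimes> coset_rep x = (w \<otimes> v) \<otimes> x" using v vc x W'_closed that by (simp add: m_assoc)
    then show "w \<otimes> coset_rep x \<in> W' #> x"
      using subgroup.m_closed[OF W'_subgroup that v(1)] by (auto simp: r_coset_def)
  qed
  then show "coset_minimal (coset_rep x)" using v vc x by (simp add: coset_minimal_def)
qed

lemma coset_rep_mult:
  assumes "w \<in> W'" "x \<in> carrier G"
  shows "coset_rep (w \<otimes> x) = coset_rep x"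
proof -
  have "w \<otimes> x \<in> W' #> x" using assms by (auto simp: r_coset_def)
  then have "W' #> (w \<otimes> x) = W' #> x" using repr_independence assms W'_subgroup by metis
  then show ?thesis by (simp add: coset_rep_def)
qed

section \<open>Existence\<close>

lemma equivariant_order_map_exists:
  "equivariant_order_map G S W' S' (\<lambda>x \<in> carrier G. x \<otimes> inv (coset_rep x))"
  unfolding equivariant_order_map_def
proof (intro conjI ballI impI)
  show "(\<lambda>x \<in> carrier G. x \<otimes> inv (coset_rep x)) \<in> carrier G \<rightarrow>\<^sub>E W'"
    using coset_rep by auto
  fix w x assume w: "w \<in> W'" and x: "x \<in> carrier G"
  have c: "w \<in> carrier G" "coset_rep x \<in> carrier G"
    using w x W'_closed coset_rep(1) by (auto simp: coset_minimal_def)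
  show "(\<lambda>x \<in> carrier G. x \<otimes> inv (coset_rep x)) (w \<otimes> x) =
      w \<otimes> (\<lambda>x \<in> carrier G. x \<otimes> inv (coset_rep x)) x"
    using w x c by (simp add: coset_rep_mult m_assoc)
next
  fix x w assume x: "x \<in> carrier G" and w: "w \<in> W'"
    and le: "bruhat_le G' S' ((\<lambda>x \<in> carrier G. x \<otimes> inv (coset_rep x)) x)
      ((\<lambda>x \<in> carrier G. x \<otimes> inv (coset_rep x)) (w \<otimes> x))"
  have c: "w \<in> carrier G" "coset_rep x \<in> carrier G"
    using w x W'_closed coset_rep(1) by (auto simp: coset_minimal_def)
  \<comment> \<open>\<open>x\<close> and \<open>w \<otimes> x\<close> share one representative;
    right multiplication by it turns this relation in W' into one between \<open>x\<close> and
    \<open>w \<otimes> x\<close>.\<close>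
  have "bruhat_le G' S' (x \<otimes> inv (coset_rep x)) (w \<otimes> x \<otimes> inv (coset_rep x))"
    using le x w c by (simp add: coset_rep_mult)
  from bruhat_le_coset_minimal[OF coset_rep(1)[OF x] this]
  show "bruhat_le G S x (w \<otimes> x)" using x c by (simp add: m_assoc)
qed

section \<open>Uniqueness and the values on W'\<close>

lemma equivariant_order_map_kernel_least:
  assumes \<phi>: "equivariant_order_map G S W' S' \<phi>"
    and x: "x \<in> carrier G" "\<phi> x = \<one>" and w: "w \<in> W'"
  shows "bruhat_le G S x (w \<otimes> x)"
proof -
  have "\<phi> (w \<otimes> x) = w"
    using \<phi> x w W'_closed unfolding equivariant_order_map_def by fastforce
  \<comment> \<open>\<open>\<one>\<close> lies below \<open>w\<close> in the order of W', and
    \<open>\<phi>\<close> sends \<open>x\<close> and \<open>w \<otimes> x\<close> to these two, so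
    condition (b) applies.\<close>
  then show ?thesis
    using \<phi> x w bruhat_le_one[OF w] unfolding equivariant_order_map_def by metis
qed

lemma equivariant_order_map_kernel:
  assumes \<phi>: "equivariant_order_map G S W' S' \<phi>" and x: "x \<in> carrier G"
  shows "\<phi> x \<in> W'" "inv (\<phi> x) \<in> W'" "\<phi> (inv (\<phi> x) \<otimes> x) = \<one>"
proof -
  show 1: "\<phi> x \<in> W'" using \<phi> x by (auto simp: equivariant_order_map_def)
  then show 2: "inv (\<phi> x) \<in> W'" by (rule subgroup.m_inv_closed[OF W'_subgroup])
  have "\<phi> (inv (\<phi> x) \<otimes> x) = inv (\<phi> x) \<otimes> \<phi> x"
    using \<phi> x 2 by (simp add: equivariant_order_map_def)
  then show "\<phi> (inv (\<phi> x) \<otimes> x) = \<one>" using W'_closed[OF 1] by simp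
qed

text \<open>In the coset of \<open>x\<close> the points where \<open>\<phi>\<close> and
  \<open>\<psi>\<close> take the value \<open>\<one>\<close> are both Bruhat-least, hence equal by
  antisymmetry; cancelling \<open>x\<close> gives equal values.\<close>

lemma equivariant_order_map_unique:
  assumes \<phi>: "equivariant_order_map G S W' S' \<phi>" and \<psi>: "equivariant_order_map G S W' S' \<psi>"
  shows "\<phi> = \<psi>"
proof (rule PiE_ext)
  show "\<phi> \<in> carrier G \<rightarrow>\<^sub>E W'" "\<psi> \<in> carrier G \<rightarrow>\<^sub>E W'"
    using \<phi> \<psi> by (auto simp: equivariant_order_map_def)
  fix x assume x: "x \<in> carrier G"
  note a = equivariant_order_map_kernel[OF \<phi> x] and b = equivariant_order_map_kernel[OF \<psi> x]
  have ac: "\<phi> x \<in> carrier G" and bc: "\<psi> x \<in> carrier G" using a b W'_closed by auto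
  have le: "bruhat_le G S (inv g \<otimes> x) (inv h \<otimes> x)"
    if "equivariant_order_map G S W' S' \<theta>" "\<theta> (inv g \<otimes> x) = \<one>" "g \<in> W'" "h \<in> W'" for \<theta> g h
  proof -
    have gh: "g \<in> carrier G" "h \<in> carrier G" using that W'_closed by auto
    have "inv h \<otimes> g \<in> W'"
      using that W'_subgroup by (auto intro: subgroup.m_closed subgroup.m_inv_closed)
    then have "bruhat_le G S (inv g \<otimes> x) (inv h \<otimes> g \<otimes> (inv g \<otimes> x))"
      using equivariant_order_map_kernel_least[OF that(1) _ that(2)] x gh by simp
    then show ?thesis using x gh by (simp add: m_assoc mult_inv_cancel_left inv_mult_cancel_left)
  qed
  have "inv (\<phi> x) \<otimes> x = inv (\<psi> x) \<otimes> x"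
    by (rule bruhat_le_antisym[OF le[OF \<phi>] le[OF \<psi>]]) (use a b in auto)
  then have "inv (\<phi> x) = inv (\<psi> x)" using x ac bc by simp
  then show "\<phi> x = \<psi> x" using ac bc by (metis inv_inv)
qed

text \<open>The point \<open>inv (\<phi> \<one>)\<close> of value \<open>\<one>\<close> lies
  Bruhat-below \<open>\<one>\<close>, which has length 0, so it is \<open>\<one>\<close> itself;
  equivariance then fixes all of W'.\<close>

lemma equivariant_order_map_id:
  assumes \<phi>: "equivariant_order_map G S W' S' \<phi>" and w: "w \<in> W'"
  shows "\<phi> w = w"
proof -
  note a = equivariant_order_map_kernel[OF \<phi> one_closed]
  have c: "\<phi> \<one> \<in> carrier G" using a W'_closed by auto
  \<comment> \<open>The multiplier \<open>\<phi> \<one>\<close> is chosen to take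
    \<open>inv (\<phi> \<one>)\<close> back to \<open>\<one>\<close>.\<close>
  have "bruhat_le G S (inv (\<phi> \<one>) \<otimes> \<one>) (\<phi> \<one> \<otimes> (inv (\<phi> \<one>) \<otimes> \<one>))"
    by (rule equivariant_order_map_kernel_least[OF \<phi>]) (use a c in auto)
  then have "inv (\<phi> \<one>) = \<one> \<or> cox_length G S (inv (\<phi> \<one>)) < cox_length G S \<one>"
    using bruhat_le_length[of G S "inv (\<phi> \<one>)" \<one>] c by simp
  moreover have "cox_length G S \<one> = 0" using cox_length_word_prod_le[of "[]" S G] by simp
  ultimately have "\<phi> \<one> = \<one>" using c by (metis inv_inv inv_one not_less_zero)
  moreover have "\<phi> (w \<otimes> \<one>) = w \<otimes> \<phi> \<one>" using \<phi> w by (simp add: equivariant_order_map_def)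
  ultimately show ?thesis using W'_closed[OF w] by simp
qed

end

theorem theorem2:
  fixes G :: "('a, 'b) monoid_scheme" and S W' S' :: "'a set"
  assumes "coxeter_system G S"
    and "finite (carrier G)"
    and "parabolic_subgroup G S W'"
    and "parabolic_simples G S W' S'"
  shows "(\<exists>!\<phi>. equivariant_order_map G S W' S' \<phi>) \<and>
    (\<forall>\<phi>. equivariant_order_map G S W' S' \<phi> \<longrightarrow> (\<forall>w \<in> W'. \<phi> w = w))"
proof -
  obtain I z where "I \<subseteq> S" "z \<in> carrier G" "W' = conj_set G z (generate G I)"
      "\<And>y. y \<in> z <#\<^bsub>G\<^esub> generate G I \<Longrightarrow> cox_length G S z \<le> cox_length G S y"
      "S' = conj_set G z I"
    using assms(4) unfolding parabolic_simples_def by blast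
  then interpret minimal_parabolic G S I z W' S'
    using assms(1) by (intro minimal_parabolic.intro minimal_parabolic_axioms.intro)
  show ?thesis
    using equivariant_order_map_exists equivariant_order_map_unique equivariant_order_map_id
    by blast
qed

end
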